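(* Let $p$ be an odd prime and $a\in\mathbb{Z}_p$. Then $$P_{p-1}(a,x)\equiv (-1)^{\langle a\rangle_p}P_{p-1}(a,-x)\pmod{p^2}$$ and so $$\sum_{k=0}^{p-1}\binom ak\binom{-1-a}k\left(x^k-(-1)^{\langle a\rangle_p}(1-x)^k\right)\equiv 0\pmod{p^2}.$$
   Context: $\mathbb{Z}_p$ denotes the set of rational $p$-integers, i.e. rational numbers whose denominator is not divisible by $p$. For $a\in\mathbb{Z}_p$, $\langle a\rangle_p\in\{0,1,\ldots,p-1\}$ is the least nonnegative residue of $a$ modulo $p$. For $n\geq 0$ an integer and $a$ arbitrary, $\binom an=a(a-1)\cdots(a-n+1)/n!$ (with $\binom a0=1$). The generalized Legendre polynomial is $$P_n(a,x)=\sum_{k=0}^n\binom ak\binom{-1-a}k\left(\frac{1-x}2\right)^k .$$ Here $x$ is a variable; a congruence modulo $p^2$ between polynomials in $x$ with coefficients in $\mathbb{Z}_p$ means that all coefficients of the difference lie in $p^2\mathbb{Z}_p$ (in particular it holds for every value $x\in\mathbb{Z}_p$). *)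

theory Defs
  imports
    "HOL-Computational_Algebra.Computational_Algebra"
    "HOL-Number_Theory.Cong"
begin

text \<open>
  The ring of rational \<open>p\<close>-integers. The second component of \<^const>\<open>quotient_of\<close> is the positive
  denominator of the reduced fraction.
\<close>

definition p_integers :: "nat \<Rightarrow> rat set" where
  "p_integers p = {r. \<not> int p dvd snd (quotient_of r)}"

text \<open>Congruence of rational numbers: the difference lies in \<open>m\<close> times the ring of \<open>p\<close>-integers.\<close>

definition p_cong :: "nat \<Rightarrow> nat \<Rightarrow> rat \<Rightarrow> rat \<Rightarrow> bool" where
  "p_cong p m x y \<longleftrightarrow> (\<exists>z\<in>p_integers p. x - y = of_nat m * z)"

definition poly_p_cong :: "nat \<Rightarrow> nat \<Rightarrow> rat poly \<Rightarrow> rat poly \<Rightarrow> bool" where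
  "poly_p_cong p m f g \<longleftrightarrow> (\<forall>i. p_cong p m (coeff f i) (coeff g i))"

text \<open>
  Only meaningful for prime \<open>p\<close> and \<open>a\<close> in \<^term>\<open>p_integers p\<close>; see \<open>ex1_least_residue\<close> below.
\<close>

definition least_residue :: "nat \<Rightarrow> rat \<Rightarrow> nat" where
  "least_residue p a = (THE r. r < p \<and> p_cong p p a (of_nat r))"

text \<open>\<open>P\<^sub>n(a, x)\<close> as a polynomial in the indeterminate \<open>x\<close>, which is \<open>[:0, 1:]\<close>.\<close>

definition gen_legendre :: "nat \<Rightarrow> rat \<Rightarrow> rat poly" where
  "gen_legendre n a =
     (\<Sum>k=0..n. smult ((a gchoose k) * ((- 1 - a) gchoose k)) (smult (1/2) (1 - [:0, 1:]) ^ k))"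

lemma p_integers_iff:
  assumes "prime p"
  shows "r \<in> p_integers p \<longleftrightarrow> (\<exists>n d. \<not> int p dvd d \<and> r = of_int n / of_int d)"
proof
  assume "r \<in> p_integers p"
  moreover have "r = of_int (fst (quotient_of r)) / of_int (snd (quotient_of r))"
    by (rule quotient_of_div) simp
  ultimately show "\<exists>n d. \<not> int p dvd d \<and> r = of_int n / of_int d"
    unfolding p_integers_def by blast
next
  assume "\<exists>n d. \<not> int p dvd d \<and> r = of_int n / of_int d"
  then obtain n d where nd: "\<not> int p dvd d" "r = of_int n / of_int d" by blast
  obtain u v where uv: "quotient_of r = (u, v)" by force
  have r: "r = of_int u / of_int v" and v: "v > 0" and cop: "coprime u v"
    using quotient_of_div[OF uv] quotient_of_denom_pos[OF uv] quotient_of_coprime[OF uv] by auto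
  have "d \<noteq> 0" using nd(1) by auto
  then have "(of_int (n * v) :: rat) = of_int (u * d)"
    using nd(2) r v by (simp add: field_simps)
  then have "n * v = u * d" by (simp only: of_int_eq_iff)
  then have "v dvd u * d" by (metis dvd_triv_right)
  then have "v dvd d" using cop by (simp add: coprime_commute coprime_dvd_mult_right_iff)
  then have "\<not> int p dvd v" using nd(1) dvd_trans by blast
  then show "r \<in> p_integers p" by (simp add: p_integers_def uv)
qed

lemma ex1_least_residue:
  assumes p: "prime p" and a: "a \<in> p_integers p"
  shows "\<exists>!r. r < p \<and> p_cong p p a (of_nat r)"
proof -
  obtain n d where nd: "\<not> int p dvd d" "a = of_int n / of_int d"
    using a p_integers_iff[OF p, of a] by blast
  have d0: "d \<noteq> 0" using nd(1) by auto
  have p0: "p > 0" using p by (simp add: prime_gt_0_nat)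
  have iff: "p_cong p p a (of_nat r) \<longleftrightarrow> int p dvd n - int r * d" for r
  proof
    assume "p_cong p p a (of_nat r)"
    then obtain z where z: "z \<in> p_integers p" "a - of_nat r = of_nat p * z"
      unfolding p_cong_def by blast
    then obtain m e where me: "\<not> int p dvd e" "a - of_nat r = of_nat p * (of_int m / of_int e)"
      using p_integers_iff[OF p, of z] by blast
    have e0: "e \<noteq> 0" using me(1) by auto
    have "(of_int ((n - int r * d) * e) :: rat) = of_int (int p * (m * d))"
      using me(2) nd(2) d0 e0 by (simp add: field_simps)
    then have "(n - int r * d) * e = int p * (m * d)" by (simp only: of_int_eq_iff)
    then have "int p dvd (n - int r * d) * e" by simp
    then show "int p dvd n - int r * d"
      using me(1) p prime_dvd_mult_iff[of "int p"] by auto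
  next
    assume "int p dvd n - int r * d"
    then obtain m where m: "n - int r * d = int p * m" by blast
    have "n = int p * m + int r * d" using m by simp
    then have "a - of_nat r = of_nat p * (of_int m / of_int d)"
      using nd(2) d0 by (simp add: field_simps)
    moreover have "of_int m / of_int d \<in> p_integers p"
      using p_integers_iff[OF p, of "of_int m / of_int d"] nd(1) by blast
    ultimately show "p_cong p p a (of_nat r)"
      unfolding p_cong_def by blast
  qed
  have cop: "coprime d (int p)"
    using nd(1) p prime_imp_coprime[of "int p" d] by (simp add: coprime_commute)
  obtain c where c: "[d * c = 1] (mod int p)"
    using cop cong_solve_coprime_int by blast
  define r where "r = nat ((n * c) mod int p)"
  have r: "int r = (n * c) mod int p" using p0 by (simp add: r_def)
  have "[int r * d = n * c * d] (mod int p)" unfolding r by (simp add: cong_def mod_mult_left_eq)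
  also have "n * c * d = n * (d * c)" by simp
  also have "[n * (d * c) = n * 1] (mod int p)" using c by (rule cong_scalar_left)
  finally have "[n = int r * d] (mod int p)" by (simp add: cong_sym)
  then have "int p dvd n - int r * d" by (simp only: cong_iff_dvd_diff)
  moreover have "r < p" using p0 r by (metis of_nat_0_less_iff of_nat_less_iff pos_mod_bound)
  moreover have "s = t"
    if "s < p" "t < p" "int p dvd n - int s * d" "int p dvd n - int t * d" for s t
  proof -
    have "int p dvd (n - int t * d) - (n - int s * d)" using that(4,3) by (rule dvd_diff)
    then have "[int s * d = int t * d] (mod int p)"
      by (simp add: cong_iff_dvd_diff algebra_simps)
    then have "[int s = int t] (mod int p)" using cop by (simp add: cong_mult_rcancel)
    then have "[s = t] (mod p)" by (simp add: cong_int_iff)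
    then show ?thesis using that by (simp add: cong_def)
  qed
  ultimately show ?thesis unfolding iff by blast
qed

end

theory Submission
  imports Defs
begin

text \<open>
  Write \<open>c\<^sub>k(a) = (a gchoose k) * ((- 1 - a) gchoose k)\<close> and \<open>a = m + p t\<close>, where \<open>m\<close> is the least
  residue of \<open>a\<close> and \<open>t\<close> is a \<open>p\<close>-integer. Say that a value \<open>b\<close> has sign \<open>e\<close> if the sum of
  \<open>c\<^sub>k(b) (y^k - e (1 - y)^k)\<close> over \<open>k < p\<close> vanishes; with \<open>y = x\<close> and \<open>y = (1 - x) / 2\<close> this is an
  exact version of the two claims. The proof rests on three observations.

  A natural number \<open>m < p\<close> has sign \<open>(- 1)^m\<close>, by the classical symmetry of the Legendre
  polynomial under \<open>x \<mapsto> 1 - x\<close>, which can be read off from its Rodrigues formula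
  (\<open>shifted_legendre_symmetric\<close>).

  Since \<open>c\<^sub>k\<close> is invariant under \<open>a \<mapsto> - 1 - a\<close>, the value \<open>m - p\<close> behaves like the natural number
  \<open>p - 1 - m\<close>, which is again less than \<open>p\<close> and, as \<open>p\<close> is odd, has the same parity as \<open>m\<close>. So the
  sum with sign \<open>(- 1)^m\<close> vanishes exactly at \<open>t = 0\<close> and also at \<open>t = - 1\<close>.

  For \<open>k < p\<close> the denominator of \<open>c\<^sub>k\<close> is prime to \<open>p\<close>, so \<open>c\<^sub>k(m + p t)\<close> is, modulo \<open>p\<^sup>2\<close>, an affine
  function of \<open>t\<close> (\<open>affine_mod_square_legendre_coeff\<close>). An affine function is determined by two
  values, and here it is \<open>(1 + t) c\<^sub>k(m) - t c\<^sub>k(m - p)\<close> (\<open>affine_mod_square_interpolate\<close>). Hence the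
  sum for \<open>a\<close> is, modulo \<open>p\<^sup>2\<close>, a combination of two sums that are zero.
\<close>

section \<open>The ring of \<open>p\<close>-integers\<close>

lemma p_integers_of_int:
  assumes "prime p"
  shows "of_int n \<in> p_integers p"
  unfolding p_integers_iff[OF assms] using assms
  by (intro exI[of _ n] exI[of _ 1]) (auto simp: not_prime_1 zdvd1_eq)

lemma p_integers_of_nat:
  assumes "prime p"
  shows "of_nat n \<in> p_integers p"
  using p_integers_of_int[OF assms, of "int n"] by simp

lemma p_integers_0: "prime p \<Longrightarrow> 0 \<in> p_integers p"
  and p_integers_1: "prime p \<Longrightarrow> 1 \<in> p_integers p"
  using p_integers_of_int[of p 0] p_integers_of_int[of p 1] by simp_all

lemma p_integers_add:
  assumes p: "prime p" and x: "x \<in> p_integers p" and y: "y \<in> p_integers p"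
  shows "x + y \<in> p_integers p"
proof -
  obtain n d where nd: "\<not> int p dvd d" "x = of_int n / of_int d"
    using x p_integers_iff[OF p] by blast
  obtain m e where me: "\<not> int p dvd e" "y = of_int m / of_int e"
    using y p_integers_iff[OF p] by blast
  have "d \<noteq> 0" "e \<noteq> 0" using nd(1) me(1) by auto
  then have "x + y = of_int (n * e + m * d) / of_int (d * e)"
    using nd(2) me(2) by (simp add: field_simps)
  moreover have "\<not> int p dvd d * e"
    using nd(1) me(1) p by (simp add: prime_dvd_mult_iff)
  ultimately show ?thesis using p_integers_iff[OF p] by blast
qed

lemma p_integers_mult:
  assumes p: "prime p" and x: "x \<in> p_integers p" and y: "y \<in> p_integers p"
  shows "x * y \<in> p_integers p"
proof -
  obtain n d where nd: "\<not> int p dvd d" "x = of_int n / of_int d"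
    using x p_integers_iff[OF p] by blast
  obtain m e where me: "\<not> int p dvd e" "y = of_int m / of_int e"
    using y p_integers_iff[OF p] by blast
  have "x * y = of_int (n * m) / of_int (d * e)"
    using nd(2) me(2) by simp
  moreover have "\<not> int p dvd d * e"
    using nd(1) me(1) p by (simp add: prime_dvd_mult_iff)
  ultimately show ?thesis using p_integers_iff[OF p] by blast
qed

lemma p_integers_minus:
  assumes "prime p" and "x \<in> p_integers p"
  shows "- x \<in> p_integers p"
  using p_integers_mult[OF assms(1) p_integers_of_int[OF assms(1), of "-1"] assms(2)] by simp

lemma p_integers_diff:
  assumes "prime p" and "x \<in> p_integers p" and "y \<in> p_integers p"
  shows "x - y \<in> p_integers p"
  using p_integers_add[OF assms(1,2) p_integers_minus[OF assms(1,3)]] by simp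

lemma p_integers_sum:
  assumes "prime p" and "\<And>i. i \<in> A \<Longrightarrow> f i \<in> p_integers p"
  shows "sum f A \<in> p_integers p"
  using assms(2)
  by (induction A rule: infinite_finite_induct)
    (auto intro: p_integers_0[OF assms(1)] p_integers_add[OF assms(1)])

lemma p_integers_inverse_of_nat:
  assumes "prime p" and "\<not> p dvd n"
  shows "1 / of_nat n \<in> p_integers p"
  unfolding p_integers_iff[OF assms(1)] using assms(2)
  by (intro exI[of _ 1] exI[of _ "int n"]) simp

lemmas p_integers_intros =
  p_integers_0 p_integers_1 p_integers_of_nat p_integers_add p_integers_mult
  p_integers_minus p_integers_diff

definition p_integral_poly :: "nat \<Rightarrow> rat poly \<Rightarrow> bool" where
  "p_integral_poly p f \<longleftrightarrow> (\<forall>i. coeff f i \<in> p_integers p)"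

lemma p_integral_poly_mult:
  assumes "prime p" and "p_integral_poly p f" and "p_integral_poly p g"
  shows "p_integral_poly p (f * g)"
  using assms unfolding p_integral_poly_def coeff_mult
  by (auto intro!: p_integers_sum p_integers_mult)

lemma p_integral_poly_1: "prime p \<Longrightarrow> p_integral_poly p 1"
  by (auto simp: p_integral_poly_def coeff_1 intro: p_integers_intros)

lemma p_integral_poly_power:
  assumes "prime p" and "p_integral_poly p f"
  shows "p_integral_poly p (f ^ k)"
  by (induction k) (auto intro: assms p_integral_poly_mult p_integral_poly_1)

lemma p_integral_poly_diff:
  assumes "prime p" and "p_integral_poly p f" and "p_integral_poly p g"
  shows "p_integral_poly p (f - g)"
  using assms by (auto simp: p_integral_poly_def intro: p_integers_intros)

lemma p_integral_poly_smult:
  assumes "prime p" and "c \<in> p_integers p" and "p_integral_poly p f"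
  shows "p_integral_poly p (smult c f)"
  using assms by (auto simp: p_integral_poly_def intro: p_integers_intros)

lemma p_integral_poly_sum:
  assumes "prime p" and "\<And>k. k \<in> A \<Longrightarrow> p_integral_poly p (f k)"
  shows "p_integral_poly p (sum f A)"
  using assms by (auto simp: p_integral_poly_def coeff_sum intro: p_integers_sum)

lemma p_integral_poly_pCons:
  assumes "c \<in> p_integers p" and "p_integral_poly p f"
  shows "p_integral_poly p (pCons c f)"
  using assms by (auto simp: p_integral_poly_def coeff_pCons split: nat.split)

lemma p_integral_poly_0: "prime p \<Longrightarrow> p_integral_poly p 0"
  by (auto simp: p_integral_poly_def intro: p_integers_0)

section \<open>Symmetry of shifted Legendre polynomials\<close>

text \<open>
  For a natural number \<open>a = m\<close> these are the coefficients of \<open>P\<^sub>m(1 - 2 x)\<close>, where \<open>P\<^sub>m\<close> is the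
  classical Legendre polynomial.
\<close>
definition legendre_coeff :: "rat \<Rightarrow> nat \<Rightarrow> rat" where
  "legendre_coeff a k = (a gchoose k) * ((- 1 - a) gchoose k)"

lemma legendre_coeff_reflect: "legendre_coeff (- 1 - a) k = legendre_coeff a k"
  by (simp add: legendre_coeff_def)

lemma legendre_coeff_of_nat:
  "legendre_coeff (of_nat m) k = (- 1) ^ k * of_nat ((m choose k) * ((m + k) choose k))"
proof -
  have upper: "(- 1 - of_nat m :: rat) = - (of_nat m + 1)"
    by simp
  have "(- 1 - of_nat m :: rat) gchoose k = (- (of_nat m + 1)) gchoose k"
    by (simp only: upper)
  also have "\<dots> = (- 1) ^ k * (of_nat (m + k) gchoose k)"
    by (subst gbinomial_minus) (simp add: add.commute)
  finally show ?thesis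
    by (simp only: legendre_coeff_def binomial_gbinomial of_nat_mult mult.left_commute)
qed

lemma smult_sum_right: "smult c (sum f A) = (\<Sum>i\<in>A. smult c (f i))"
  by (induction A rule: infinite_finite_induct) (auto simp: smult_add_right)

lemma pcompose_power: "pcompose (f ^ n) g = pcompose f g ^ n"
  for f g :: "'a :: comm_semiring_1 poly"
  by (induction n) (auto simp: pcompose_mult pcompose_1)

lemma higher_pderiv_monom_add:
  "(pderiv ^^ n) (monom c (n + k)) = monom (pochhammer (of_nat (Suc k)) n * c) k"
  by (rule poly_eqI) (auto simp: coeff_higher_pderiv)

text \<open>
  Expanding \<open>x^m (1 - x)^m\<close> binomially, the \<open>m\<close>-th derivative turns \<open>x^(m + k)\<close> into
  \<open>(m + k)! / k! x^k\<close>, and \<open>(m + k)! / k!\<close> is \<open>m!\<close> times the second binomial factor of the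
  coefficient, up to its sign.
\<close>
lemma rodrigues_shifted_legendre:
  "smult (fact m) (\<Sum>k=0..m. smult (legendre_coeff (of_nat m) k) ([:0, 1:] ^ k))
     = (pderiv ^^ m) (([:0, 1:] * (1 - [:0, 1:])) ^ m)"
proof -
  have X: "([:0, 1:] :: rat poly) ^ k = monom 1 k" for k
    by (simp add: monom_altdef)
  have "([:0, 1:] * (1 - [:0, 1:]) :: rat poly) ^ m = [:0, 1:] ^ m * (- [:0, 1:] + 1) ^ m"
    by (simp only: power_mult_distrib) (simp add: one_pCons)
  also have "\<dots> = (\<Sum>k=0..m. of_nat (m choose k) * ([:0, 1:] ^ m * (- [:0, 1:]) ^ k))"
    unfolding binomial_ring sum_distrib_left atMost_atLeast0
    by (rule sum.cong[OF refl]) (simp only: power_one mult_1_right ac_simps)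
  also have "\<dots> = (\<Sum>k=0..m. monom ((- 1) ^ k * of_nat (m choose k)) (m + k))"
  proof (rule sum.cong[OF refl])
    fix k
    have "(- [:0, 1:] :: rat poly) ^ k = monom ((- 1) ^ k) k"
      by (subst power_minus, subst X) (simp add: minus_one_power_iff minus_monom)
    then show "of_nat (m choose k) * ([:0, 1:] ^ m * (- [:0, 1:]) ^ k)
        = (monom ((- 1) ^ k * of_nat (m choose k)) (m + k) :: rat poly)"
      by (simp only: X mult_monom of_nat_monom add_0 mult_1_left mult.commute)
  qed
  finally have expand: "([:0, 1:] * (1 - [:0, 1:]) :: rat poly) ^ m =
      (\<Sum>k=0..m. monom ((- 1) ^ k * of_nat (m choose k)) (m + k))" .
  have coeff: "pochhammer (of_nat (Suc k)) m * ((- 1) ^ k * of_nat (m choose k))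
      = fact m * legendre_coeff (of_nat m) k" for k
  proof -
    have "fact m * fact k * of_nat ((m + k) choose k) = (fact (m + k) :: rat)"
      using binomial_fact_lemma[of k "m + k"]
      by (metis add.commute add_diff_cancel_right' le_add1 mult.commute of_nat_fact of_nat_mult)
    moreover have "fact (m + k) = (fact k * pochhammer (of_nat (Suc k)) m :: rat)"
      using pochhammer_product'[of "1 :: rat" k m]
      by (simp add: pochhammer_fact add.commute)
    ultimately have "pochhammer (of_nat (Suc k)) m = (fact m * of_nat ((m + k) choose k) :: rat)"
      by (metis (no_types) fact_nonzero mult.assoc mult.left_commute mult_left_cancel)
    then show ?thesis by (simp add: legendre_coeff_of_nat)
  qed
  show ?thesis
    unfolding expand higher_pderiv_sum higher_pderiv_monom_add smult_sum_right coeff X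
    by (simp add: smult_monom)
qed

lemma higher_pderiv_reflect:
  fixes f :: "rat poly"
  shows "pcompose ((pderiv ^^ m) f) (1 - [:0, 1:])
    = smult ((- 1) ^ m) ((pderiv ^^ m) (pcompose f (1 - [:0, 1:])))"
proof (induction m)
  case (Suc m)
  have "pderiv (pcompose ((pderiv ^^ m) f) (1 - [:0, 1:]))
      = - pcompose (pderiv ((pderiv ^^ m) f)) (1 - [:0, 1:])"
    by (simp add: pderiv_pcompose pderiv_diff pderiv_pCons)
  then show ?case
    using Suc by (simp add: pderiv_smult minus_equation_iff)
qed simp

text \<open>
  The weight \<open>(x (1 - x))^m\<close> is invariant under \<open>x \<mapsto> 1 - x\<close>, and each of the \<open>m\<close> derivatives in
  Rodrigues' formula contributes one sign. Allowing any \<open>n \<ge> m\<close> as upper limit, which only adds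
  zero terms, lets \<open>m\<close> and \<open>p - 1 - m\<close> share the summation range \<open>0..p - 1\<close>; substituting an
  arbitrary \<open>y\<close> serves both the variable \<open>x\<close> and \<open>(1 - x) / 2\<close>.
\<close>
lemma shifted_legendre_symmetric:
  assumes "m \<le> n"
  shows "(\<Sum>k=0..n. smult (legendre_coeff (of_nat m) k)
           (y ^ k - smult ((- 1) ^ m) ((1 - y) ^ k))) = 0"
proof -
  define L :: "rat poly" where "L = (\<Sum>k=0..m. smult (legendre_coeff (of_nat m) k) ([:0, 1:] ^ k))"
  have weight: "pcompose (([:0, 1:] * (1 - [:0, 1:])) ^ m) (1 - [:0, 1:])
      = ([:0, 1:] * (1 - [:0, 1:]) :: rat poly) ^ m"
    by (simp add: pcompose_power pcompose_mult pcompose_diff pcompose_1 pcompose_pCons mult.commute)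
  have "smult (fact m) (pcompose L (1 - [:0, 1:])) = smult (fact m) (smult ((- 1) ^ m) L)"
    using higher_pderiv_reflect[of m "([:0, 1:] * (1 - [:0, 1:])) ^ m"]
    unfolding weight rodrigues_shifted_legendre[symmetric] L_def[symmetric]
    by (simp add: pcompose_smult mult.commute)
  then have "smult (1 / fact m) (smult (fact m) (pcompose L (1 - [:0, 1:])))
      = smult (1 / fact m) (smult (fact m) (smult ((- 1) ^ m) L))"
    by (rule arg_cong)
  then have L: "pcompose L (1 - [:0, 1:]) = smult ((- 1) ^ m) L"
    by simp
  have comp: "pcompose L z = (\<Sum>k=0..m. smult (legendre_coeff (of_nat m) k) (z ^ k))" for z
    unfolding L_def pcompose_sum pcompose_smult pcompose_power by (simp add: pcompose_pCons)
  have "pcompose L (1 - y) = pcompose (pcompose L (1 - [:0, 1:])) y"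
    by (simp add: pcompose_assoc [symmetric] pcompose_diff pcompose_1 pcompose_pCons)
  also have "\<dots> = smult ((- 1) ^ m) (pcompose L y)"
    by (simp add: L pcompose_smult)
  finally have refl: "pcompose L y = smult ((- 1) ^ m) (pcompose L (1 - y))"
    by (simp add: minus_one_power_iff)
  have "(\<Sum>k=0..n. smult (legendre_coeff (of_nat m) k)
           (y ^ k - smult ((- 1) ^ m) ((1 - y) ^ k)))
      = (\<Sum>k=0..m. smult (legendre_coeff (of_nat m) k)
           (y ^ k - smult ((- 1) ^ m) ((1 - y) ^ k)))"
    using assms by (intro sum.mono_neutral_right) (auto simp: legendre_coeff_of_nat)
  also have "\<dots> = pcompose L y - smult ((- 1) ^ m) (pcompose L (1 - y))"
    by (simp add: comp smult_diff_right sum_subtractf smult_sum_right mult.commute)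
  finally show ?thesis using refl by simp
qed

section \<open>Affine dependence modulo \<open>p\<^sup>2\<close>\<close>

text \<open>
  The slope carries the factor \<open>p\<close>, so the product of two slopes disappears modulo \<open>p\<^sup>2\<close>; this
  makes the property stable under products, and it describes functions of \<open>m + p t\<close>.
\<close>
definition affine_mod_square :: "nat \<Rightarrow> (rat \<Rightarrow> rat) \<Rightarrow> bool" where
  "affine_mod_square p f \<longleftrightarrow>
     (\<exists>A\<in>p_integers p. \<exists>B\<in>p_integers p. \<forall>t\<in>p_integers p.
        p_cong p (p\<^sup>2) (f t) (A + of_nat p * B * t))"

lemma affine_mod_square_linear:
  assumes "prime p" and "A \<in> p_integers p" and "B \<in> p_integers p"
  shows "affine_mod_square p (\<lambda>t. A + of_nat p * B * t)"
  unfolding affine_mod_square_def p_cong_def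
  by (intro bexI[of _ A] bexI[of _ B] ballI bexI[of _ 0])
    (auto intro: assms p_integers_0)

lemma affine_mod_square_mult:
  assumes p: "prime p" and f: "affine_mod_square p f" and g: "affine_mod_square p g"
  shows "affine_mod_square p (\<lambda>t. f t * g t)"
proof -
  obtain A B where A: "A \<in> p_integers p" and B: "B \<in> p_integers p"
    and f: "\<And>t. t \<in> p_integers p \<Longrightarrow> p_cong p (p\<^sup>2) (f t) (A + of_nat p * B * t)"
    using f unfolding affine_mod_square_def by blast
  obtain C D where C: "C \<in> p_integers p" and D: "D \<in> p_integers p"
    and g: "\<And>t. t \<in> p_integers p \<Longrightarrow> p_cong p (p\<^sup>2) (g t) (C + of_nat p * D * t)"
    using g unfolding affine_mod_square_def by blast
  have "p_cong p (p\<^sup>2) (f t * g t) (A * C + of_nat p * (A * D + B * C) * t)"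
    if t: "t \<in> p_integers p" for t
  proof -
    obtain r where r: "r \<in> p_integers p" "f t - (A + of_nat p * B * t) = of_nat (p\<^sup>2) * r"
      using f[OF t] unfolding p_cong_def by blast
    obtain s where s: "s \<in> p_integers p" "g t - (C + of_nat p * D * t) = of_nat (p\<^sup>2) * s"
      using g[OF t] unfolding p_cong_def by blast
    have ft: "f t = A + of_nat p * B * t + of_nat (p\<^sup>2) * r"
      and gt: "g t = C + of_nat p * D * t + of_nat (p\<^sup>2) * s"
      using r(2) s(2) by (simp_all add: algebra_simps)
    have "f t * g t - (A * C + of_nat p * (A * D + B * C) * t) = of_nat (p\<^sup>2) *
        (B * D * t * t + r * (C + of_nat p * D * t + of_nat p * of_nat p * s)
          + s * (A + of_nat p * B * t))"
      unfolding ft gt by (simp add: algebra_simps power2_eq_square)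
    then show ?thesis unfolding p_cong_def
      by (rule bexI) (intro p_integers_intros p A B C D r s t)
  qed
  then show ?thesis unfolding affine_mod_square_def
    by (intro bexI[of _ "A * C"] bexI[of _ "A * D + B * C"] ballI)
      (auto intro!: p_integers_intros p A B C D)
qed

lemma affine_mod_square_const:
  assumes "prime p" and "A \<in> p_integers p"
  shows "affine_mod_square p (\<lambda>t. A)"
  using affine_mod_square_linear[OF assms p_integers_0[OF assms(1)]] by simp

lemma affine_mod_square_prod:
  assumes "prime p" and "\<And>i. i \<in> I \<Longrightarrow> affine_mod_square p (f i)"
  shows "affine_mod_square p (\<lambda>t. \<Prod>i\<in>I. f i t)"
  using assms(2)
  by (induction I rule: infinite_finite_induct)
    (auto intro: affine_mod_square_const[OF assms(1)] affine_mod_square_mult[OF assms(1)]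
       p_integers_1[OF assms(1)])

text \<open>
  The nodes \<open>0\<close> and \<open>- 1\<close> are those at which \<open>m + p t\<close> is, possibly after the reflection
  \<open>a \<mapsto> - 1 - a\<close>, a natural number less than \<open>p\<close>.
\<close>
lemma affine_mod_square_interpolate:
  assumes p: "prime p" and f: "affine_mod_square p f" and t: "t \<in> p_integers p"
  shows "p_cong p (p\<^sup>2) (f t) ((1 + t) * f 0 - t * f (- 1))"
proof -
  obtain A B where f: "\<And>t. t \<in> p_integers p \<Longrightarrow> p_cong p (p\<^sup>2) (f t) (A + of_nat p * B * t)"
    using f unfolding affine_mod_square_def by blast
  obtain r where r: "r \<in> p_integers p" "f t - (A + of_nat p * B * t) = of_nat (p\<^sup>2) * r"
    using f[OF t] unfolding p_cong_def by blast
  obtain u where u: "u \<in> p_integers p" "f 0 - (A + of_nat p * B * 0) = of_nat (p\<^sup>2) * u"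
    using f[OF p_integers_0[OF p]] unfolding p_cong_def by blast
  have "- 1 \<in> p_integers p" by (intro p_integers_intros p)
  then obtain v where v: "v \<in> p_integers p" "f (- 1) - (A + of_nat p * B * (- 1)) = of_nat (p\<^sup>2) * v"
    using f unfolding p_cong_def by blast
  have ft: "f t = A + of_nat p * B * t + of_nat (p\<^sup>2) * r" and f0: "f 0 = A + of_nat (p\<^sup>2) * u"
    and f1: "f (- 1) = A - of_nat p * B + of_nat (p\<^sup>2) * v"
    using r(2) u(2) v(2) by (simp_all add: algebra_simps)
  have "f t - ((1 + t) * f 0 - t * f (- 1)) = of_nat (p\<^sup>2) * (r - (1 + t) * u + t * v)"
    unfolding ft f0 f1 by (simp add: algebra_simps)
  then show ?thesis unfolding p_cong_def
    by (rule bexI) (intro p_integers_intros p r u v t)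
qed

text \<open>
  The coefficient is a product of factors linear in \<open>p t\<close>, divided by \<open>(k!)\<^sup>2\<close>, which is invertible
  modulo \<open>p\<close> because \<open>k < p\<close>.
\<close>
lemma affine_mod_square_legendre_coeff:
  assumes p: "prime p" and k: "k < p" and m: "m \<in> p_integers p"
  shows "affine_mod_square p (\<lambda>t. legendre_coeff (m + of_nat p * t) k)"
proof -
  have "\<not> p dvd fact k"
    using p k by (simp add: prime_dvd_fact_iff)
  then have inv: "1 / of_nat (fact k) \<in> p_integers p"
    by (rule p_integers_inverse_of_nat[OF p])
  have first: "affine_mod_square p (\<lambda>t. m + of_nat p * t - of_nat i)" for i
  proof -
    have "affine_mod_square p (\<lambda>t. (m - of_nat i) + of_nat p * 1 * t)"
      by (rule affine_mod_square_linear) (intro p_integers_intros p m)+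
    then show ?thesis by (simp add: algebra_simps)
  qed
  have second: "affine_mod_square p (\<lambda>t. - 1 - (m + of_nat p * t) - of_nat i)" for i
  proof -
    have "affine_mod_square p (\<lambda>t. (- 1 - m - of_nat i) + of_nat p * (- 1) * t)"
      by (rule affine_mod_square_linear) (intro p_integers_intros p m)+
    then show ?thesis by (simp add: algebra_simps)
  qed
  have "legendre_coeff (m + of_nat p * t) k =
      (1 / of_nat (fact k)) * (\<Prod>i=0..<k. m + of_nat p * t - of_nat i) *
      ((1 / of_nat (fact k)) * (\<Prod>i=0..<k. - 1 - (m + of_nat p * t) - of_nat i))" for t
    by (simp add: legendre_coeff_def gbinomial_prod_rev)
  then show ?thesis
    by (simp only:) (intro affine_mod_square_mult affine_mod_square_prod affine_mod_square_const
        p inv first second)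
qed

section \<open>The congruence\<close>

text \<open>
  The coefficients are interpolated between \<open>a = m\<close> and \<open>a = m - p\<close>. By reflection the latter gives
  the coefficients of \<open>p - 1 - m\<close>, and both interpolated sums vanish by the exact symmetry, leaving
  only the error terms \<open>p\<^sup>2 r\<^sub>k\<close>.
\<close>
lemma legendre_sum_congruence:
  assumes p: "prime p" and odd: "odd p" and a: "a \<in> p_integers p" and y: "p_integral_poly p y"
  shows "poly_p_cong p (p\<^sup>2)
     (\<Sum>k=0..p - 1. smult (legendre_coeff a k)
        (y ^ k - smult ((- 1) ^ least_residue p a) ((1 - y) ^ k))) 0"
proof -
  define m where "m = least_residue p a"
  have "m < p \<and> p_cong p p a (of_nat m)"
    unfolding m_def least_residue_def by (rule theI'[OF ex1_least_residue[OF p a]])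
  then obtain t where m: "m < p" and t: "t \<in> p_integers p" and at: "a = of_nat m + of_nat p * t"
    unfolding p_cong_def by (auto simp: algebra_simps)
  define Q where "Q k = y ^ k - smult ((- 1) ^ m) ((1 - y) ^ k)" for k
  have "(- 1) ^ m \<in> p_integers p"
    using p_integers_of_int[OF p, of "(- 1) ^ m"] by simp
  then have Q: "p_integral_poly p (Q k)" for k
    unfolding Q_def
    by (intro p_integral_poly_diff p_integral_poly_power p_integral_poly_smult
        p_integral_poly_1 p y)
  have "\<exists>r. k < p \<longrightarrow> r \<in> p_integers p \<and> legendre_coeff a k =
      (1 + t) * legendre_coeff (of_nat m) k - t * legendre_coeff (of_nat (p - 1 - m)) k
        + of_nat (p\<^sup>2) * r" for k
  proof (cases "k < p")
    case True
    have *: "of_nat (p - 1 - m) = (- 1 - (of_nat m - of_nat p) :: rat)"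
      using m by (simp add: of_nat_diff)
    have "legendre_coeff (of_nat (p - 1 - m)) k = legendre_coeff (of_nat m - of_nat p) k"
      unfolding * by (rule legendre_coeff_reflect)
    then show ?thesis
      using affine_mod_square_interpolate[OF p
          affine_mod_square_legendre_coeff[OF p True p_integers_of_nat[OF p, of m]] t]
      unfolding p_cong_def by (auto simp: at algebra_simps)
  qed simp
  then obtain r where r: "\<And>k. k < p \<Longrightarrow> r k \<in> p_integers p"
    and c: "\<And>k. k < p \<Longrightarrow> legendre_coeff a k =
      (1 + t) * legendre_coeff (of_nat m) k - t * legendre_coeff (of_nat (p - 1 - m)) k
        + of_nat (p\<^sup>2) * r k"
    by metis
  have p0: "p > 0" using p by (simp add: prime_gt_0_nat)
  have S0: "(\<Sum>k=0..p - 1. smult (legendre_coeff (of_nat m) k) (Q k)) = 0"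
    unfolding Q_def using m by (intro shifted_legendre_symmetric) auto
  \<comment> \<open>Oddness of \<open>p\<close> makes the signs at the two interpolation nodes agree.\<close>
  have "even (p - 1)" using odd by simp
  then have "even (p - 1 - m) \<longleftrightarrow> even m" using m by (auto simp: even_diff_nat)
  then have "(- 1 :: rat) ^ m = (- 1) ^ (p - 1 - m)"
    by (simp add: minus_one_power_iff)
  then have S1: "(\<Sum>k=0..p - 1. smult (legendre_coeff (of_nat (p - 1 - m)) k) (Q k)) = 0"
    unfolding Q_def using shifted_legendre_symmetric[of "p - 1 - m" "p - 1" y] by simp
  have "(\<Sum>k=0..p - 1. smult (legendre_coeff a k) (Q k))
      = (\<Sum>k=0..p - 1. smult (1 + t) (smult (legendre_coeff (of_nat m) k) (Q k))
          - smult t (smult (legendre_coeff (of_nat (p - 1 - m)) k) (Q k))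
          + smult (of_nat (p\<^sup>2)) (smult (r k) (Q k)))"
    using p0 by (intro sum.cong refl, subst c)
      (auto simp: smult_add_left smult_diff_left)
  also have "\<dots> = smult (of_nat (p\<^sup>2)) (\<Sum>k=0..p - 1. smult (r k) (Q k))"
    unfolding sum.distrib sum_subtractf smult_sum_right[symmetric] S0 S1 by simp
  finally have "(\<Sum>k=0..p - 1. smult (legendre_coeff a k) (Q k)) = \<dots>" .
  moreover have "p_integral_poly p (\<Sum>k=0..p - 1. smult (r k) (Q k))"
    using p0 by (intro p_integral_poly_sum p_integral_poly_smult p Q r) auto
  ultimately have "poly_p_cong p (p\<^sup>2) (\<Sum>k=0..p - 1. smult (legendre_coeff a k) (Q k)) 0"
    unfolding poly_p_cong_def p_cong_def p_integral_poly_def by auto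
  then show ?thesis unfolding Q_def m_def .
qed

lemma poly_p_cong_diff_0: "poly_p_cong p m f g \<longleftrightarrow> poly_p_cong p m (f - g) 0"
  by (simp add: poly_p_cong_def p_cong_def)

theorem theorem2p2:
  fixes p :: nat and a :: rat
  assumes "prime p" and "odd p" and "a \<in> p_integers p"
  shows "poly_p_cong p (p\<^sup>2)
           (gen_legendre (p - 1) a)
           (smult ((- 1) ^ least_residue p a) (pcompose (gen_legendre (p - 1) a) (- [:0, 1:])))
       \<and> poly_p_cong p (p\<^sup>2)
           (\<Sum>k=0..p - 1. smult ((a gchoose k) * ((- 1 - a) gchoose k))
              ([:0, 1:] ^ k - smult ((- 1) ^ least_residue p a) ((1 - [:0, 1:]) ^ k)))
           0"
proof
  note p = assms(1)
  let ?e = "(- 1 :: rat) ^ least_residue p a"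
  define y :: "rat poly" where "y = smult (1/2) (1 - [:0, 1:])"
  have X: "p_integral_poly p [:0, 1:]"
    by (intro p_integral_poly_pCons p_integral_poly_0 p_integers_0 p_integers_1 p)
  have "\<not> p dvd 2"
    using p assms(2) primes_dvd_imp_eq two_is_prime_nat by blast
  then have half: "1 / 2 \<in> p_integers p"
    using p_integers_inverse_of_nat[OF p, of 2] by simp
  have y: "p_integral_poly p y" unfolding y_def
    by (intro p_integral_poly_smult p_integral_poly_diff p_integral_poly_1 p half X)
  \<comment> \<open>Replacing \<open>x\<close> by \<open>- x\<close> exchanges \<open>y\<close> and \<open>1 - y\<close>, so the first claim is the case
    \<open>y = (1 - x) / 2\<close> of the congruence and the second is the case \<open>y = x\<close>.\<close>
  have y': "pcompose y (- [:0, 1:]) = 1 - y"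
    by (simp add: y_def one_pCons pcompose_pCons)
  have "gen_legendre (p - 1) a - smult ?e (pcompose (gen_legendre (p - 1) a) (- [:0, 1:]))
      = (\<Sum>k=0..p - 1. smult (legendre_coeff a k) (y ^ k - smult ?e ((1 - y) ^ k)))"
    unfolding gen_legendre_def y_def[symmetric] legendre_coeff_def[symmetric]
    by (simp only: pcompose_sum pcompose_smult pcompose_power y' smult_sum_right
        smult_diff_right sum_subtractf smult_smult mult.commute)
  then show "poly_p_cong p (p\<^sup>2) (gen_legendre (p - 1) a)
      (smult ?e (pcompose (gen_legendre (p - 1) a) (- [:0, 1:])))"
    using legendre_sum_congruence[OF assms y] by (subst poly_p_cong_diff_0) (simp only:)
  show "poly_p_cong p (p\<^sup>2)
           (\<Sum>k=0..p - 1. smult ((a gchoose k) * ((- 1 - a) gchoose k))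
              ([:0, 1:] ^ k - smult ?e ((1 - [:0, 1:]) ^ k))) 0"
    using legendre_sum_congruence[OF assms X] unfolding legendre_coeff_def .
qed

end
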